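(* Let $G$ be a connected graph of order $n\geq 4$ and size $m$ with clique number $\omega\geq 2$. Let $H=G\setminus K_{\omega}$ be the graph obtained by deleting the edges of a clique $K_\omega$ of $G$ (keeping all vertices), and suppose $H$ has $r$ non-trivial components $C_1,\dots,C_r$, each of which is a $c$-cyclic graph (besides possibly some isolated vertices). Let \[\gamma_{1}=\frac{2\omega+3-\sqrt{16\omega+8r(c-1)+9}}{2},\quad \Delta_1=\min\{\omega-2,\gamma_{1}\},\quad \beta_1=\frac{3+\sqrt{4\omega^{2}-4\omega+8r(c-1)+9}}{2}.\] Then $S_k(G)\leq m+\frac{k(k+1)}{2}$ for every integer $k\in[1,\Delta_1]$ and every integer $k\in[\beta_1,n]$.
   Context: The Laplacian matrix of a graph is $L(G)=D(G)-A(G)$ with eigenvalues $\mu_1\ge\dots\ge\mu_n=0$; $S_k(G)=\sum_{i=1}^k\mu_i$. A $c$-cyclic graph is a connected graph with $n'$ vertices and $n'+c-1$ edges. A non-trivial component is a component with at least two vertices. *)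

theory Defs
  imports "HOL-Analysis.Analysis" "HOL-Computational_Algebra.Computational_Algebra"
begin

text \<open>A finite simple graph is given by a vertex set and a set of two-element edges.\<close>

definition simple_graph :: "'v set \<Rightarrow> 'v set set \<Rightarrow> bool" where
  "simple_graph V E \<longleftrightarrow> finite V \<and> (\<forall>e\<in>E. e \<subseteq> V \<and> card e = 2)"

definition reachable :: "'v set set \<Rightarrow> 'v \<Rightarrow> 'v \<Rightarrow> bool" where
  "reachable E u v \<longleftrightarrow> (u, v) \<in> {(x, y). {x, y} \<in> E}\<^sup>*"

definition connected_graph :: "'v set \<Rightarrow> 'v set set \<Rightarrow> bool" where
  "connected_graph V E \<longleftrightarrow>
     simple_graph V E \<and> V \<noteq> {} \<and> (\<forall>u\<in>V. \<forall>v\<in>V. reachable E u v)"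

text \<open>A component is represented by its vertex set; it carries the edges lying inside that set.\<close>

definition graph_components :: "'v set \<Rightarrow> 'v set set \<Rightarrow> 'v set set" where
  "graph_components V E = {{u \<in> V. reachable E v u} | v. v \<in> V}"

definition nontrivial_components :: "'v set \<Rightarrow> 'v set set \<Rightarrow> 'v set set" where
  "nontrivial_components V E = {C \<in> graph_components V E. 2 \<le> card C}"

definition induced_edges :: "'v set set \<Rightarrow> 'v set \<Rightarrow> 'v set set" where
  "induced_edges E C = {e \<in> E. e \<subseteq> C}"

text \<open>The equation says that there are \<open>card V + c - 1\<close> edges, avoiding truncated subtraction.\<close>

definition c_cyclic :: "nat \<Rightarrow> 'v set \<Rightarrow> 'v set set \<Rightarrow> bool" where
  "c_cyclic c V E \<longleftrightarrow> connected_graph V E \<and> card E + 1 = card V + c"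

definition clique :: "'v set \<Rightarrow> 'v set set \<Rightarrow> 'v set \<Rightarrow> bool" where
  "clique V E K \<longleftrightarrow> K \<subseteq> V \<and> (\<forall>u\<in>K. \<forall>v\<in>K. u \<noteq> v \<longrightarrow> {u, v} \<in> E)"

definition clique_number :: "'v set \<Rightarrow> 'v set set \<Rightarrow> nat" where
  "clique_number V E = Max (card ` {K. clique V E K})"

text \<open>The matrices are those of a graph whose vertex set is the whole index type.\<close>

definition degree_matrix :: "'v::finite set set \<Rightarrow> real^'v^'v" where
  "degree_matrix E = (\<chi> u v. if u = v then real (card {e \<in> E. u \<in> e}) else 0)"

definition adjacency_matrix :: "'v::finite set set \<Rightarrow> real^'v^'v" where
  "adjacency_matrix E = (\<chi> u v. if {u, v} \<in> E then 1 else 0)"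

definition laplacian :: "'v::finite set set \<Rightarrow> real^'v^'v" where
  "laplacian E = degree_matrix E - adjacency_matrix E"

definition charpoly :: "real^'v::finite^'v \<Rightarrow> real poly" where
  "charpoly A = det (\<chi> u v. (if u = v then [:0, 1:] else 0) - [:A $ u $ v:])"

text \<open>The real eigenvalues with algebraic multiplicity, in non-increasing order. A Laplacian is a
  real symmetric matrix, so for it the list has one entry per vertex.\<close>

definition eigenvalue_list :: "real^'v::finite^'v \<Rightarrow> real list" where
  "eigenvalue_list A = rev (sorted_list_of_multiset (proots (charpoly A)))"

definition laplacian_sum :: "'v::finite set set \<Rightarrow> nat \<Rightarrow> real" where
  "laplacian_sum E k = (\<Sum>i<k. eigenvalue_list (laplacian E) ! i)"

end

(*
  Ky Fan: the sum of the k largest Laplacian eigenvalues is the Laplacian quadratic form summed over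
  k orthonormal eigenvectors, so it is at most the same sums for the clique and for H added up.
  The clique contributes at most k \<omega> (largest eigenvalue) and at most \<omega> (\<omega> - 1) (trace).
  For H take a spanning star forest F of its non-isolated vertices. A star with t leaves has a single
  eigenvalue above 2, namely t + 1, so its Laplacian is at most 2 I plus a rank one matrix of trace
  t - 1; every edge outside F has trace 2. This gives 2 k + 2 |H| - |\<Union>H|, and the c-cyclic components
  have |\<Union>H| = |H| - r (c - 1). The conditions on k are what the two resulting quadratic
  inequalities require.
*)

theory Submission
  imports Defs
begin

section \<open>Spectral theorem and sums of largest eigenvalues\<close>

text \<open>A maximiser \<open>v\<close> of the Rayleigh quotient on the unit sphere of
  \<open>S\<close> is an eigenvector, and its orthogonal complement in \<open>S\<close> is again
  invariant because \<open>A\<close> is self-adjoint. Invariant subspaces, rather than the whole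
  space, make induction on the dimension possible.\<close>

lemma selfadjoint_eigenbasis:
  fixes A :: "'a::euclidean_space \<Rightarrow> 'a"
  assumes A: "linear A" and sym: "\<And>x y. A x \<bullet> y = x \<bullet> A y"
    and S: "subspace S" "\<And>x. x \<in> S \<Longrightarrow> A x \<in> S"
  shows "\<exists>B. B \<subseteq> S \<and> pairwise orthogonal B \<and> (\<forall>b\<in>B. norm b = 1 \<and> (\<exists>\<mu>. A b = \<mu> *\<^sub>R b)) \<and> S \<subseteq> span B"
  using S
proof (induction "dim S" arbitrary: S rule: less_induct)
  case less
  interpret A: linear A by (rule A)
  note S = less.prems(1) and inv = less.prems(2)
  show ?case
  proof (cases "S \<subseteq> {0}")
    case True
    then show ?thesis by (intro exI[of _ "{}"]) (auto simp: pairwise_def)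
  next
    case False
    then obtain y where y: "y \<in> S" "y \<noteq> 0" by auto
    let ?U = "S \<inter> sphere 0 1"
    have "y /\<^sub>R norm y \<in> ?U"
      using y S by (auto simp: subspace_scale)
    then have "?U \<noteq> {}" by blast
    moreover have "compact ?U"
      by (simp add: S closed_Int_compact closed_subspace)
    moreover have "continuous_on ?U (\<lambda>x. x \<bullet> A x)"
      using A by (intro continuous_intros linear_continuous_on) (simp add: linear_conv_bounded_linear)
    ultimately obtain v where v: "v \<in> ?U" and vmax: "\<And>x. x \<in> ?U \<Longrightarrow> x \<bullet> A x \<le> v \<bullet> A v"
      using continuous_attains_sup by metis
    define \<mu> where "\<mu> = v \<bullet> A v"
    have vS: "v \<in> S" and nv: "norm v = 1" "v \<bullet> v = 1"
      using v by (auto simp: dot_square_norm)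
    \<comment> \<open>Homogeneity carries the maximum from the unit sphere to all of
      \<open>S\<close>.\<close>
    have q: "x \<bullet> A x \<le> \<mu> * (x \<bullet> x)" if "x \<in> S" for x
    proof (cases "x = 0")
      case False
      have "x /\<^sub>R norm x \<in> ?U"
        using that False S by (auto simp: subspace_scale)
      from vmax[OF this] have "x \<bullet> A x / (norm x * norm x) \<le> \<mu>"
        by (simp add: \<mu>_def A.scale divide_inverse mult_ac)
      then show ?thesis using False
        by (simp add: divide_le_eq dot_square_norm power2_eq_square)
    qed simp
    have "A v = \<mu> *\<^sub>R v"
    proof -
      define z where "z = A v - \<mu> *\<^sub>R v"
      have zS: "z \<in> S" unfolding z_def using S vS inv
        by (simp add: subspace_diff subspace_scale)
      have zz: "z \<bullet> A v - \<mu> * (z \<bullet> v) = z \<bullet> z"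
        by (simp add: z_def inner_diff_left inner_diff_right inner_commute algebra_simps)
      \<comment> \<open>First variation: \<open>q\<close> at \<open>v + t z\<close>. The constant
        terms cancel and the residual \<open>z\<close> turns the linear term into
        \<open>2 t (z \<bullet> z)\<close>, so only \<open>z = 0\<close> is compatible with small
        positive \<open>t\<close>.\<close>
      have main: "2 * t * (z \<bullet> z) \<le> t\<^sup>2 * (\<mu> * (z \<bullet> z) - z \<bullet> A z)" for t
      proof -
        have "v + t *\<^sub>R z \<in> S" using S vS zS by (simp add: subspace_add subspace_scale)
        from q[OF this] have "\<mu> + 2 * t * (z \<bullet> A v) + t\<^sup>2 * (z \<bullet> A z)
            \<le> \<mu> * (1 + 2 * t * (z \<bullet> v) + t\<^sup>2 * (z \<bullet> z))"
          using sym[of v z]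
          by (simp add: A.add A.scale inner_add_left inner_add_right nv \<mu>_def[symmetric]
              inner_commute power2_eq_square algebra_simps)
        moreover have "2 * t * (z \<bullet> A v - \<mu> * (z \<bullet> v)) = 2 * t * (z \<bullet> z)"
          by (simp only: zz)
        ultimately show ?thesis by (simp add: algebra_simps)
      qed
      have "z = 0"
      proof (rule ccontr)
        assume "z \<noteq> 0"
        then have pos: "z \<bullet> z > 0" by simp
        \<comment> \<open>A positive upper bound for the coefficient of the squared term; at
          \<open>t = (z \<bullet> z) / d\<close> the linear term is twice what the quadratic term
          can reach.\<close>
        define d where "d = \<bar>\<mu> * (z \<bullet> z) - z \<bullet> A z\<bar> + 1"
        have d: "d > 0" "\<mu> * (z \<bullet> z) - z \<bullet> A z \<le> d" by (auto simp: d_def)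
        have "2 * (z \<bullet> z / d) * (z \<bullet> z) \<le> (z \<bullet> z / d)\<^sup>2 * d"
          using main[of "z \<bullet> z / d"] mult_left_mono[OF d(2), of "(z \<bullet> z / d)\<^sup>2"] by simp
        also have "\<dots> = (z \<bullet> z / d) * (z \<bullet> z)"
          using d(1) by (simp add: power2_eq_square)
        finally have "(z \<bullet> z / d) * (z \<bullet> z) \<le> 0" by simp
        moreover have "(z \<bullet> z / d) * (z \<bullet> z) > 0"
          using d(1) pos by (intro mult_pos_pos divide_pos_pos)
        ultimately show False by simp
      qed
      then show ?thesis by (simp add: z_def)
    qed
    define S' where "S' = {x \<in> S. v \<bullet> x = 0}"
    have S': "subspace S'"
      using S by (auto simp: S'_def subspace_def inner_add_right)
    have "v \<notin> S'" using nv by (simp add: S'_def)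
    moreover have "S' \<subseteq> S" by (auto simp: S'_def)
    ultimately have "S' \<subset> S" using vS by blast
    then have "dim S' < dim S"
      using S S' by (metis dim_psubset span_eq_iff)
    moreover have "A x \<in> S'" if "x \<in> S'" for x
      using that inv sym[of v x] \<open>A v = \<mu> *\<^sub>R v\<close> by (auto simp: S'_def)
    ultimately obtain B where B: "B \<subseteq> S'" "pairwise orthogonal B"
        "\<forall>b\<in>B. norm b = 1 \<and> (\<exists>\<mu>. A b = \<mu> *\<^sub>R b)" "S' \<subseteq> span B"
      using less.hyps S' by blast
    have "S \<subseteq> span (insert v B)"
    proof
      fix x assume "x \<in> S"
      then have "x - (v \<bullet> x) *\<^sub>R v \<in> S'"
        using S vS nv by (simp add: S'_def subspace_diff subspace_scale inner_diff_right)
      then have "x - (v \<bullet> x) *\<^sub>R v \<in> span B" using B(4) by blast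
      then show "x \<in> span (insert v B)"
        using span_breakdown_eq by blast
    qed
    moreover have "pairwise orthogonal (insert v B)"
      using B(1,2) by (auto simp: pairwise_insert orthogonal_def S'_def inner_commute)
    ultimately show ?thesis
      using B nv vS \<open>A v = \<mu> *\<^sub>R v\<close> by (intro exI[of _ "insert v B"]) (auto simp: S'_def)
  qed
qed

text \<open>The basis is indexed by the matrix's own index type, so that its vectors can be the
  columns of a square matrix.\<close>

lemma symmetric_matrix_eigenbasis:
  fixes A :: "real^'n^'n"
  assumes "transpose A = A"
  obtains f :: "'n \<Rightarrow> real^'n" and \<mu> :: "'n \<Rightarrow> real"
  where "\<And>i j. f i \<bullet> f j = (if i = j then 1 else 0)" "\<And>i. A *v f i = \<mu> i *\<^sub>R f i"
proof -
  have "(A *v x) \<bullet> y = x \<bullet> (A *v y)" for x y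
    using dot_lmul_matrix[of x A y] transpose_matrix_vector[of A x] by (simp add: assms)
  from selfadjoint_eigenbasis[OF matrix_vector_mul_linear this subspace_UNIV]
  obtain B where B: "pairwise orthogonal B" "\<And>b. b \<in> B \<Longrightarrow> norm b = 1"
      "\<And>b. b \<in> B \<Longrightarrow> \<exists>\<mu>. A *v b = \<mu> *\<^sub>R b" "UNIV \<subseteq> span B"
    by auto
  have "independent B"
    using B(1) B(2)[of 0] by (intro pairwise_orthogonal_independent) auto
  moreover have "span B = span (UNIV :: (real^'n) set)"
    using B(4) by auto
  ultimately have "finite B" "card B = CARD('n)"
    using dim_eq_card[of B "UNIV :: (real^'n) set"] by (simp_all add: independent_imp_finite)
  then obtain f :: "'n \<Rightarrow> real^'n" where f: "bij_betw f UNIV B"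
    using finite_same_card_bij[of "UNIV :: 'n set" B] by auto
  have fB: "f i \<in> B" for i using f by (auto simp: bij_betw_def)
  have "f i \<bullet> f j = (if i = j then 1 else 0)" for i j
  proof (cases "i = j")
    case False
    then have "f i \<noteq> f j" using f by (auto simp: bij_betw_def inj_on_def)
    then show ?thesis using B(1) fB False by (auto simp: pairwise_def orthogonal_def)
  qed (use B(2) fB in \<open>auto simp: dot_square_norm\<close>)
  moreover obtain \<mu> where "\<And>i. A *v f i = \<mu> i *\<^sub>R f i"
    using B(3)[OF fB] by metis
  ultimately show thesis by (rule that)
qed

lemma poly_det:
  fixes M :: "'a::comm_ring_1 poly^'n^'n"
  shows "poly (det M) x = det (\<chi> i j. poly (M $ i $ j) x)"
  by (simp add: det_def poly_sum poly_prod)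

text \<open>The orthogonal matrix \<open>Q\<close> with columns \<open>f j\<close> diagonalises
  \<open>A\<close>. Evaluating at each real \<open>x\<close> first reduces the claim to determinants
  of real matrices, where \<open>det Q\<close> can be cancelled.\<close>

lemma charpoly_eigenbasis:
  fixes A :: "real^'n^'n" and f :: "'n \<Rightarrow> real^'n"
  assumes orth: "\<And>i j. f i \<bullet> f j = (if i = j then 1 else 0)"
    and eig: "\<And>i. A *v f i = \<mu> i *\<^sub>R f i"
  shows "charpoly A = (\<Prod>i\<in>UNIV. [:- \<mu> i, 1:])"
proof -
  define Q where "Q = (\<chi> i j. f j $ i)"
  have "transpose Q ** Q = mat 1"
    using orth by (simp add: Q_def vec_eq_iff matrix_matrix_mult_def transpose_def mat_def inner_vec_def)
  then have "det Q * det Q = 1"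
    by (metis det_I det_mul det_transpose)
  then have Q0: "det Q \<noteq> 0" by auto
  have "poly (charpoly A) x = poly (\<Prod>i\<in>UNIV. [:- \<mu> i, 1:]) x" for x
  proof -
    define M where "M = (\<chi> u v. (if u = v then x else 0) - A $ u $ v)"
    define D :: "real^'n^'n" where "D = (\<chi> u v. if u = v then x - \<mu> u else 0)"
    have "M ** Q = Q ** D"
    proof -
      have "(\<Sum>k\<in>UNIV. A $ i $ k * f j $ k) = \<mu> j * f j $ i" for i j
        using eig[of j] by (simp add: vec_eq_iff matrix_vector_mult_def)
      moreover have "M $ i $ k * f j $ k = (if i = k then x * f j $ k else 0) - A $ i $ k * f j $ k" for i j k
        by (simp add: M_def left_diff_distrib)
      ultimately have "(\<Sum>k\<in>UNIV. M $ i $ k * f j $ k) = (x - \<mu> j) * f j $ i" for i j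
        by (simp add: sum_subtractf left_diff_distrib)
      then show ?thesis
        by (simp add: vec_eq_iff matrix_matrix_mult_def D_def Q_def if_distrib[of "(*) _"] cong: if_cong)
    qed
    then have "det M = det D"
      using Q0 det_mul[of M Q] det_mul[of Q D] by simp
    moreover have "poly (charpoly A) x = det M"
      unfolding charpoly_def poly_det M_def
      by (intro arg_cong[where f = det]) (simp add: vec_eq_iff)
    moreover have "det D = (\<Prod>i\<in>UNIV. x - \<mu> i)"
      by (subst det_diagonal) (auto simp: D_def)
    ultimately show ?thesis by (simp add: poly_prod)
  qed
  then show ?thesis by (simp add: poly_eq_poly_eq_iff[symmetric] fun_eq_iff)
qed

text \<open>The case of equality in Ky Fan's principle, attained by eigenvectors of the
  \<open>k\<close> largest eigenvalues. The later estimates hold for every orthonormal family and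
  hence for this one.\<close>

lemma sum_eigenvalue_list:
  fixes A :: "real^'n^'n"
  assumes "transpose A = A" and k: "k \<le> CARD('n)"
  obtains f :: "'n \<Rightarrow> real^'n" and I :: "'n set"
  where "\<And>i j. f i \<bullet> f j = (if i = j then 1 else 0)" "card I = k"
    "(\<Sum>i<k. eigenvalue_list A ! i) = (\<Sum>i\<in>I. f i \<bullet> (A *v f i))"
proof -
  obtain f :: "'n \<Rightarrow> real^'n" and \<mu>
    where f: "\<And>i j. f i \<bullet> f j = (if i = j then 1 else 0)" "\<And>i. A *v f i = \<mu> i *\<^sub>R f i"
    using symmetric_matrix_eigenbasis[OF assms(1)] by metis
  obtain us :: "'n list" where us: "set us = UNIV" "distinct us"
    using finite_distinct_list[OF finite] by blast
  have "proots (charpoly A) = (\<Sum>i\<in>UNIV. {#\<mu> i#})"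
    by (subst charpoly_eigenbasis[OF f], subst proots_prod) auto
  also have "\<dots> = (\<Sum>i\<in>set us. {#\<mu> i#})" by (simp add: us)
  also have "\<dots> = mset (map \<mu> us)"
    using us(2) by (induction us) auto
  finally have "eigenvalue_list A = rev (sort (map \<mu> us))"
    unfolding eigenvalue_list_def by (simp only: sorted_list_of_multiset_mset)
  \<comment> \<open>Sorting the indices by eigenvalue instead of sorting the values keeps track of
    which eigenvector belongs to each list entry.\<close>
  moreover have "sort (map \<mu> us) = map \<mu> (sort_key \<mu> us)"
    by (rule properties_for_sort) auto
  ultimately have ev: "eigenvalue_list A = map \<mu> (rev (sort_key \<mu> us))"
    by (simp add: rev_map)
  define ys where "ys = rev (sort_key \<mu> us)"
  have ys: "distinct ys" "length ys = CARD('n)"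
    using us distinct_card[of us] by (simp_all add: ys_def)
  have "(\<Sum>i<k. eigenvalue_list A ! i) = sum_list (map \<mu> (take k ys))"
    using k ys by (simp add: ev flip: ys_def) (simp add: sum_list_sum_nth atLeast0LessThan)
  also have "\<dots> = (\<Sum>i\<in>set (take k ys). \<mu> i)"
    using ys by (subst sum_list_distinct_conv_sum_set) auto
  also have "\<dots> = (\<Sum>i\<in>set (take k ys). f i \<bullet> (A *v f i))"
    by (simp add: f)
  finally show thesis
    using that[of f "set (take k ys)"] f(1) k ys by (simp add: distinct_card)
qed

section \<open>Bessel's inequality and Laplacian quadratic forms\<close>

text \<open>The residual of \<open>w\<close> after projection to the span of the \<open>f i\<close>
  has nonnegative squared norm. Read as a bound on forms: a rank one term contributes at most its
  trace \<open>w \<bullet> w\<close> to a sum over an orthonormal family.\<close>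

lemma bessel_inequality:
  fixes f :: "'i \<Rightarrow> 'a::real_inner"
  assumes "finite I" and orth: "\<And>i j. i \<in> I \<Longrightarrow> j \<in> I \<Longrightarrow> f i \<bullet> f j = (if i = j then 1 else 0)"
  shows "(\<Sum>i\<in>I. (w \<bullet> f i)\<^sup>2) \<le> w \<bullet> w"
proof -
  define p where "p = (\<Sum>i\<in>I. (w \<bullet> f i) *\<^sub>R f i)"
  have "p \<bullet> f i = w \<bullet> f i" if "i \<in> I" for i
    using that assms(1) by (simp add: p_def inner_sum_left orth if_distrib cong: if_cong)
  then have "p \<bullet> p = (\<Sum>i\<in>I. (w \<bullet> f i)\<^sup>2)"
    by (subst (2) p_def) (simp add: inner_sum_right power2_eq_square)
  moreover have "w \<bullet> p = (\<Sum>i\<in>I. (w \<bullet> f i)\<^sup>2)"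
    by (simp add: p_def inner_sum_right power2_eq_square)
  moreover have "0 \<le> (w - p) \<bullet> (w - p)" by simp
  ultimately show ?thesis
    by (simp add: inner_diff_left inner_diff_right inner_commute)
qed

lemma transpose_laplacian: "transpose (laplacian E) = laplacian E"
  by (auto simp: laplacian_def degree_matrix_def adjacency_matrix_def transpose_def vec_eq_iff insert_commute)

lemma laplacian_Un_disjoint:
  fixes E F :: "'v::finite set set"
  assumes "E \<inter> F = {}"
  shows "laplacian (E \<union> F) = laplacian E + laplacian F"
proof -
  have "card {e \<in> E \<union> F. u \<in> e} = card {e \<in> E. u \<in> e} + card {e \<in> F. u \<in> e}" for u
    using assms by (subst card_Un_disjoint[symmetric]) (auto intro!: arg_cong[where f = card])
  then show ?thesis
    using assms by (auto simp: laplacian_def degree_matrix_def adjacency_matrix_def vec_eq_iff)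
qed

definition laplacian_form :: "'v::finite set set \<Rightarrow> real^'v \<Rightarrow> real" where
  "laplacian_form E x = x \<bullet> (laplacian E *v x)"

lemma laplacian_form_Un_disjoint:
  "E \<inter> F = {} \<Longrightarrow> laplacian_form (E \<union> F) x = laplacian_form E x + laplacian_form F x"
  by (simp add: laplacian_form_def laplacian_Un_disjoint matrix_vector_mult_add_rdistrib inner_add_right)

lemma laplacian_form_empty: "laplacian_form {} x = 0"
proof -
  have "laplacian ({} :: 'a set set) = 0"
    by (simp add: laplacian_def degree_matrix_def adjacency_matrix_def vec_eq_iff)
  then show ?thesis by (simp add: laplacian_form_def)
qed

lemma laplacian_form_sum:
  fixes E :: "'v::finite set set"
  shows "laplacian_form E x = (\<Sum>e\<in>E. laplacian_form {e} x)"
proof -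
  have "finite E" by simp
  then show ?thesis
  proof (induction E rule: finite_induct)
    case (insert e E)
    then show ?case
      using laplacian_form_Un_disjoint[of "{e}" E x] by simp
  qed (simp add: laplacian_form_empty)
qed

text \<open>The Laplacian of a single edge is the rank one matrix with entries
  \<open>w $ i * w $ j\<close>, which puts it within reach of Bessel's inequality.\<close>

lemma laplacian_form_edge:
  fixes u v :: "'v::finite"
  assumes "u \<noteq> v"
  shows "laplacian_form {{u, v}} x = ((axis u 1 - axis v 1) \<bullet> x)\<^sup>2"
proof -
  define w :: "real^'v" where "w = axis u 1 - axis v 1"
  have deg: "card {e. e = {u, v} \<and> i \<in> e} = (if i \<in> {u, v} then 1 else 0)" for i
  proof -
    have "{e. e = {u, v} \<and> i \<in> e} = (if i \<in> {u, v} then {{u, v}} else {})" by auto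
    then show ?thesis by simp
  qed
  have "laplacian {{u, v}} $ i $ j = w $ i * w $ j" for i j
    using assms by (auto simp: laplacian_def degree_matrix_def adjacency_matrix_def w_def axis_def
        deg doubleton_eq_iff)
  then have "laplacian {{u, v}} *v x = (w \<bullet> x) *\<^sub>R w"
    by (simp add: vec_eq_iff matrix_vector_mult_def inner_vec_def sum_distrib_left mult_ac)
  then show ?thesis
    by (simp add: laplacian_form_def w_def power2_eq_square inner_commute)
qed

text \<open>By Bessel each edge contributes at most the squared norm of
  \<open>axis u 1 - axis v 1\<close>, which is 2. This is the trace bound.\<close>

lemma sum_laplacian_form_le_twice_card:
  fixes E :: "'v::finite set set" and f :: "'i \<Rightarrow> real^'v"
  assumes E: "simple_graph UNIV E" and I: "finite I"
    and orth: "\<And>i j. i \<in> I \<Longrightarrow> j \<in> I \<Longrightarrow> f i \<bullet> f j = (if i = j then 1 else 0)"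
  shows "(\<Sum>i\<in>I. laplacian_form E (f i)) \<le> 2 * real (card E)"
proof -
  have "(\<Sum>i\<in>I. laplacian_form {e} (f i)) \<le> 2" if "e \<in> E" for e
  proof -
    have "card e = 2" using E that by (simp add: simple_graph_def)
    then obtain u v where "e = {u, v}" "u \<noteq> v" by (auto simp: card_2_iff)
    then show ?thesis
      using bessel_inequality[OF I orth, of "axis u 1 - axis v 1"]
      by (simp add: laplacian_form_edge inner_diff_left inner_diff_right inner_axis_axis)
  qed
  then have "(\<Sum>e\<in>E. \<Sum>i\<in>I. laplacian_form {e} (f i)) \<le> (\<Sum>e\<in>E. 2)"
    by (rule sum_mono)
  then show ?thesis
    by (subst laplacian_form_sum) (simp add: sum.swap[of _ I])
qed

text \<open>With \<open>z\<close> the indicator vector of \<open>K\<close>, the Laplacian is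
  \<open>card K\<close> times the coordinate projection to \<open>K\<close> minus the rank one
  matrix of \<open>z\<close>. Dropping the latter and enlarging the projection to the identity only
  increases the form.\<close>

lemma laplacian_form_complete_le:
  fixes K :: "'v::finite set"
  assumes E: "E = {e. e \<subseteq> K \<and> card e = 2}"
  shows "laplacian_form E x \<le> real (card K) * (x \<bullet> x)"
proof -
  define z :: "real^'v" where "z = (\<chi> i. if i \<in> K then 1 else 0)"
  have deg: "card {e \<in> E. i \<in> e} = (if i \<in> K then card K - 1 else 0)" for i
  proof (cases "i \<in> K")
    case True
    have "bij_betw (\<lambda>j. {i, j}) (K - {i}) {e \<in> E. i \<in> e}"
      unfolding bij_betw_def
    proof (intro conjI inj_onI equalityI subsetI)
      fix e assume "e \<in> {e \<in> E. i \<in> e}"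
      then have "e \<subseteq> K" "card e = 2" "i \<in> e" by (auto simp: E)
      then show "e \<in> (\<lambda>j. {i, j}) ` (K - {i})" by (auto simp: card_2_iff)
    qed (use True in \<open>auto simp: E doubleton_eq_iff\<close>)
    then show ?thesis using True by (simp flip: bij_betw_same_card)
  qed (auto simp: E)
  have entry: "laplacian E $ i $ j = (if i = j then real (card K) * z $ i else 0) - z $ i * z $ j" for i j
  proof (cases "i = j")
    case True
    moreover have "real (card K - 1) = real (card K) - 1" if "i \<in> K"
      using that by (metis One_nat_def card_gt_0_iff empty_iff finite of_nat_1 of_nat_diff Suc_leI)
    moreover have "{j, j} \<notin> E" by (simp add: E)
    ultimately show ?thesis
      by (simp add: laplacian_def degree_matrix_def adjacency_matrix_def z_def deg)
  qed (auto simp: laplacian_def degree_matrix_def adjacency_matrix_def z_def E)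
  have "laplacian E $ i $ j * x $ j
      = (if i = j then real (card K) * z $ i * x $ i else 0) - z $ i * (z $ j * x $ j)" for i j
    by (simp add: entry left_diff_distrib)
  then have "(laplacian E *v x) $ i = real (card K) * z $ i * x $ i - z $ i * (z \<bullet> x)" for i
    by (simp add: matrix_vector_mult_def sum_subtractf inner_vec_def flip: sum_distrib_left)
  then have "laplacian_form E x = (\<Sum>i\<in>UNIV. x $ i * (real (card K) * z $ i * x $ i - z $ i * (z \<bullet> x)))"
    by (simp add: laplacian_form_def inner_vec_def)
  also have "\<dots> = (\<Sum>i\<in>UNIV. real (card K) * (z $ i * (x $ i)\<^sup>2)) - (z \<bullet> x) * (\<Sum>i\<in>UNIV. z $ i * x $ i)"
    by (simp add: right_diff_distrib sum_subtractf sum_distrib_left power2_eq_square mult_ac)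
  also have "(\<Sum>i\<in>UNIV. z $ i * x $ i) = z \<bullet> x" by (simp add: inner_vec_def)
  also have "(\<Sum>i\<in>UNIV. real (card K) * (z $ i * (x $ i)\<^sup>2)) - (z \<bullet> x) * (z \<bullet> x)
      \<le> (\<Sum>i\<in>UNIV. real (card K) * (x $ i)\<^sup>2)"
  proof -
    have "(\<Sum>i\<in>UNIV. real (card K) * (z $ i * (x $ i)\<^sup>2)) \<le> (\<Sum>i\<in>UNIV. real (card K) * (x $ i)\<^sup>2)"
      by (intro sum_mono mult_left_mono) (simp_all add: z_def)
    moreover have "0 \<le> (z \<bullet> x) * (z \<bullet> x)" by simp
    ultimately show ?thesis by linarith
  qed
  also have "\<dots> = real (card K) * (x \<bullet> x)"
    by (simp add: inner_vec_def sum_distrib_left power2_eq_square)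
  finally show ?thesis .
qed

section \<open>Star forests and the bound for \<open>H\<close>\<close>

text \<open>The defect between the two sides is at least \<open>2 (a + \<Sum> y)\<^sup>2 / (t + 1)\<close> with \<open>t = card T\<close>.\<close>

lemma star_inequality:
  fixes a :: real and y :: "'e \<Rightarrow> real"
  assumes "finite T" "T \<noteq> {}"
  defines "t \<equiv> real (card T)"
  shows "(\<Sum>e\<in>T. (a - y e)\<^sup>2) \<le> 2 * a\<^sup>2 + 2 * (\<Sum>e\<in>T. (y e)\<^sup>2)
    + (t - 1) / (t * (t + 1)) * (t * a - (\<Sum>e\<in>T. y e))\<^sup>2"
proof -
  define s q where "s = (\<Sum>e\<in>T. y e)" and "q = (\<Sum>e\<in>T. (y e)\<^sup>2)"
  have t: "t > 0" using assms by (simp add: t_def card_gt_0_iff)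
  \<comment> \<open>Cauchy-Schwarz. Once \<open>q\<close> is replaced by
    \<open>s\<^sup>2 / t\<close>, the difference of the two sides is an exact multiple of a
    square.\<close>
  have "s\<^sup>2 \<le> t * q"
    using sum_squared_le_sum_of_squares[of y T] assms(1,2)
    unfolding s_def q_def t_def by (simp add: mult.commute)
  then have cs: "s\<^sup>2 / t \<le> q" using t by (simp add: divide_le_eq mult.commute)
  have "(\<Sum>e\<in>T. (a - y e)\<^sup>2) = t * a\<^sup>2 - 2 * a * s + q"
    by (simp add: power2_diff sum.distrib sum_subtractf t_def s_def q_def sum_distrib_left)
  moreover have "2 * a\<^sup>2 + s\<^sup>2 / t + (t - 1) / (t * (t + 1)) * (t * a - s)\<^sup>2 - (t * a\<^sup>2 - 2 * a * s)
      = 2 * (a + s)\<^sup>2 / (t + 1)"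
    using t by (simp add: divide_simps) (simp add: algebra_simps power2_eq_square)
  moreover have "2 * (a + s)\<^sup>2 / (t + 1) \<ge> 0" using t by simp
  ultimately show ?thesis
    using cs unfolding s_def[symmetric] q_def[symmetric] by linarith
qed

text \<open>In a cover of least cardinality every edge has a private endpoint: otherwise deleting
  the edge would leave a smaller cover.\<close>

lemma minimal_edge_cover:
  assumes "finite H"
  obtains F where "F \<subseteq> H" "\<Union>F = \<Union>H" "\<And>e. e \<in> F \<Longrightarrow> \<exists>v\<in>e. \<forall>e'\<in>F. v \<in> e' \<longrightarrow> e' = e"
proof -
  obtain F where F: "F \<subseteq> H" "\<Union>F = \<Union>H"
    and least: "\<And>F'. F' \<subseteq> H \<and> \<Union>F' = \<Union>H \<Longrightarrow> card F \<le> card F'"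
    using ex_has_least_nat[of "\<lambda>F. F \<subseteq> H \<and> \<Union>F = \<Union>H" H card] by (auto simp del: Sup_insert)
  have "\<exists>v\<in>e. \<forall>e'\<in>F. v \<in> e' \<longrightarrow> e' = e" if "e \<in> F" for e
  proof (rule ccontr)
    assume "\<not> ?thesis"
    then have "e \<subseteq> \<Union>(F - {e})" by blast
    then have "\<Union>(F - {e}) = \<Union>F" by blast
    with F have "card F \<le> card (F - {e})" by (intro least) auto
    moreover have "card (F - {e}) < card F"
      using that F(1) assms by (intro card_Diff1_less) (auto intro: finite_subset)
    ultimately show False by simp
  qed
  with F show thesis by (rule that)
qed

text \<open>In a minimal edge cover every edge has an endpoint covered by no other edge; these endpoints
  are the leaves \<open>l e\<close> of a star forest, the opposite endpoints \<open>z e\<close> its centres.\<close>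

lemma spanning_star_forest:
  assumes "simple_graph V H" "finite H"
  obtains F and z l :: "'v set \<Rightarrow> 'v" where
    "F \<subseteq> H" "\<And>e. e \<in> F \<Longrightarrow> e = {z e, l e} \<and> z e \<noteq> l e" "inj_on l F"
    "z ` F \<inter> l ` F = {}" "z ` F \<union> l ` F = \<Union>H"
proof -
  obtain F where F: "F \<subseteq> H" "\<Union>F = \<Union>H" "\<And>e. e \<in> F \<Longrightarrow> \<exists>v\<in>e. \<forall>e'\<in>F. v \<in> e' \<longrightarrow> e' = e"
    using minimal_edge_cover[OF assms(2)] by metis
  obtain l where l: "\<And>e. e \<in> F \<Longrightarrow> l e \<in> e"
      "\<And>e e'. e \<in> F \<Longrightarrow> e' \<in> F \<Longrightarrow> l e \<in> e' \<Longrightarrow> e' = e"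
    using F(3) by metis
  have "\<exists>u. e = {u, l e} \<and> u \<noteq> l e" if "e \<in> F" for e
  proof -
    have "card e = 2" using that F(1) assms(1) by (auto simp: simple_graph_def)
    then show ?thesis using l(1)[OF that] by (auto simp: card_2_iff)
  qed
  then obtain z where z: "\<And>e. e \<in> F \<Longrightarrow> e = {z e, l e} \<and> z e \<noteq> l e" by metis
  show thesis
  proof (rule that[OF F(1) z])
    show "inj_on l F" using l by (metis inj_onI)
    \<comment> \<open>If a centre \<open>z e\<close> were a leaf \<open>l e'\<close>, then that leaf
      would lie in \<open>e\<close>, and privacy would give \<open>e = e'\<close>, against
      \<open>z e \<noteq> l e\<close>.\<close>
    show "z ` F \<inter> l ` F = {}"
    proof (rule ccontr)
      assume "z ` F \<inter> l ` F \<noteq> {}"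
      then obtain e e' where e: "e \<in> F" "e' \<in> F" "z e = l e'" by auto
      have "z e \<in> e" using z[OF e(1)] by (metis insertI1)
      with e have "e = e'" by (intro l(2)) simp_all
      with e z show False by metis
    qed
    have "\<Union>F = z ` F \<union> l ` F"
    proof (intro equalityI subsetI)
      fix x assume "x \<in> \<Union>F"
      then show "x \<in> z ` F \<union> l ` F" using z by blast
    next
      fix x assume "x \<in> z ` F \<union> l ` F"
      then show "x \<in> \<Union>F" using z by blast
    qed
    then show "z ` F \<union> l ` F = \<Union>H" using F(2) by simp
  qed
qed

lemma sum_laplacian_form_star_bound:
  fixes H :: "'v::finite set set" and f :: "'i \<Rightarrow> real^'v"
  assumes H: "simple_graph UNIV H" and I: "finite I"
    and orth: "\<And>i j. i \<in> I \<Longrightarrow> j \<in> I \<Longrightarrow> f i \<bullet> f j = (if i = j then 1 else 0)"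
  shows "(\<Sum>i\<in>I. laplacian_form H (f i)) \<le> 2 * real (card I) + 2 * real (card H) - real (card (\<Union>H))"
proof -
  obtain F and z l :: "'v set \<Rightarrow> 'v" where F: "F \<subseteq> H"
    and zl: "\<And>e. e \<in> F \<Longrightarrow> e = {z e, l e} \<and> z e \<noteq> l e" and inj: "inj_on l F"
    and disj: "z ` F \<inter> l ` F = {}" and cover: "z ` F \<union> l ` F = \<Union>H"
    using spanning_star_forest[OF H finite] by metis
  define T where "T = (\<lambda>a. {e \<in> F. z e = a})"
  define t where "t = (\<lambda>a. real (card (T a)))"
  \<comment> \<open>\<open>w a\<close> is the eigenvector of the star at \<open>a\<close> for its
    eigenvalue \<open>t a + 1\<close>, of squared norm \<open>t a * (t a + 1)\<close>. The factor
    \<open>\<kappa> a\<close> is chosen so that the rank one term carries exactly the excess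
    \<open>t a - 1\<close> of this eigenvalue over 2.\<close>
  define w :: "'v \<Rightarrow> real^'v" where "w = (\<lambda>a. t a *\<^sub>R axis a 1 - (\<Sum>e\<in>T a. axis (l e) 1))"
  define \<kappa> where "\<kappa> = (\<lambda>a. (t a - 1) / (t a * (t a + 1)))"
  have grp: "(\<Sum>e\<in>F. h e) = (\<Sum>a\<in>z ` F. \<Sum>e\<in>T a. h e)" for h :: "'v set \<Rightarrow> real"
    unfolding T_def by (rule sum.image_gen) simp
  have T_ne: "T a \<noteq> {}" if "a \<in> z ` F" for a
    using that by (auto simp: T_def)
  have t_pos: "t a > 0" "t a \<ge> 1" if "a \<in> z ` F" for a
  proof -
    have "card (T a) \<ge> 1" using T_ne[OF that] by (simp add: Suc_le_eq card_gt_0_iff)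
    then show "t a > 0" "t a \<ge> 1" by (simp_all add: t_def)
  qed
  have \<kappa>_nonneg: "\<kappa> a \<ge> 0" if "a \<in> z ` F" for a
    using t_pos[OF that] by (simp add: \<kappa>_def)
  have form_F: "laplacian_form F x \<le> 2 * (x \<bullet> x) + (\<Sum>a\<in>z ` F. \<kappa> a * (w a \<bullet> x)\<^sup>2)" for x
  proof -
    have "laplacian_form {e} x = (x $ z e - x $ l e)\<^sup>2" if "e \<in> F" for e
      using laplacian_form_edge[of "z e" "l e" x] zl[OF that]
      by (simp add: inner_diff_left inner_axis')
    then have "laplacian_form F x = (\<Sum>e\<in>F. (x $ z e - x $ l e)\<^sup>2)"
      by (subst laplacian_form_sum) simp
    also have "\<dots> = (\<Sum>a\<in>z ` F. \<Sum>e\<in>T a. (x $ a - x $ l e)\<^sup>2)"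
      unfolding grp by (intro sum.cong refl) (auto simp: T_def)
    also have "\<dots> \<le> (\<Sum>a\<in>z ` F. 2 * (x $ a)\<^sup>2 + 2 * (\<Sum>e\<in>T a. (x $ l e)\<^sup>2) + \<kappa> a * (w a \<bullet> x)\<^sup>2)"
    proof (rule sum_mono)
      fix a assume "a \<in> z ` F"
      moreover have "w a \<bullet> x = t a * x $ a - (\<Sum>e\<in>T a. x $ l e)"
        by (simp add: w_def inner_diff_left inner_sum_left inner_axis')
      ultimately show "(\<Sum>e\<in>T a. (x $ a - x $ l e)\<^sup>2)
          \<le> 2 * (x $ a)\<^sup>2 + 2 * (\<Sum>e\<in>T a. (x $ l e)\<^sup>2) + \<kappa> a * (w a \<bullet> x)\<^sup>2"
        using star_inequality[of "T a" "x $ a" "\<lambda>e. x $ l e"] T_ne by (simp add: \<kappa>_def t_def)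
    qed
    also have "\<dots> = 2 * ((\<Sum>a\<in>z ` F. (x $ a)\<^sup>2) + (\<Sum>e\<in>F. (x $ l e)\<^sup>2)) + (\<Sum>a\<in>z ` F. \<kappa> a * (w a \<bullet> x)\<^sup>2)"
      by (simp add: grp sum.distrib sum_distrib_left)
    also have "(\<Sum>e\<in>F. (x $ l e)\<^sup>2) = (\<Sum>v\<in>l ` F. (x $ v)\<^sup>2)"
      using inj by (simp add: sum.reindex)
    \<comment> \<open>The stars are vertex-disjoint, so each coordinate is counted at most once and
      the star bounds add up to a single \<open>2 * (x \<bullet> x)\<close>.\<close>
    also have "(\<Sum>a\<in>z ` F. (x $ a)\<^sup>2) + (\<Sum>v\<in>l ` F. (x $ v)\<^sup>2) = (\<Sum>v\<in>z ` F \<union> l ` F. (x $ v)\<^sup>2)"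
      using disj by (simp add: sum.union_disjoint)
    also have "\<dots> \<le> (\<Sum>v\<in>UNIV. (x $ v)\<^sup>2)"
      by (rule sum_mono2) auto
    also have "\<dots> = x \<bullet> x" by (simp add: inner_vec_def power2_eq_square)
    finally show ?thesis by simp
  qed
  have w_norm: "\<kappa> a * (w a \<bullet> w a) = t a - 1" if "a \<in> z ` F" for a
  proof -
    define s :: "real^'v" where "s = (\<Sum>e\<in>T a. axis (l e) 1)"
    have "axis a 1 \<bullet> s = 0"
    proof -
      have "a \<noteq> l e" if "e \<in> T a" for e
        using \<open>a \<in> z ` F\<close> that disj by (auto simp: T_def)
      then show ?thesis by (simp add: s_def inner_sum_right inner_axis_axis)
    qed
    \<comment> \<open>Injectivity of \<open>l\<close> makes the leaves of a star distinct, so their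
      axis vectors are orthonormal.\<close>
    moreover have "s \<bullet> s = t a"
    proof -
      have "axis (l e) 1 \<bullet> s = 1" if "e \<in> T a" for e
      proof -
        have "axis (l e) 1 \<bullet> s = (\<Sum>e'\<in>T a. if e' = e then 1 else 0)"
          unfolding s_def inner_sum_right
          using inj that by (intro sum.cong refl) (auto simp: inner_axis_axis inj_on_def T_def)
        then show ?thesis using that by simp
      qed
      then show ?thesis by (subst s_def) (simp add: inner_sum_left t_def)
    qed
    ultimately have "w a \<bullet> w a = t a * (t a + 1)"
      by (simp add: w_def flip: s_def)
        (simp add: inner_diff_left inner_diff_right inner_commute inner_axis_axis algebra_simps)
    then show ?thesis using t_pos[OF that] by (simp add: \<kappa>_def)
  qed
  have "(\<Sum>i\<in>I. laplacian_form F (f i))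
      \<le> (\<Sum>i\<in>I. 2 * (f i \<bullet> f i) + (\<Sum>a\<in>z ` F. \<kappa> a * (w a \<bullet> f i)\<^sup>2))"
    by (rule sum_mono) (rule form_F)
  also have "\<dots> = 2 * real (card I) + (\<Sum>a\<in>z ` F. \<kappa> a * (\<Sum>i\<in>I. (w a \<bullet> f i)\<^sup>2))"
    using orth by (simp add: sum.distrib sum_distrib_left sum.swap[of _ I])
  \<comment> \<open>Bessel for each \<open>w a\<close>; its direction holds up under multiplication
    because \<open>\<kappa> a\<close> is nonnegative, which rests on every star having at least one
    leaf.\<close>
  also have "(\<Sum>a\<in>z ` F. \<kappa> a * (\<Sum>i\<in>I. (w a \<bullet> f i)\<^sup>2)) \<le> (\<Sum>a\<in>z ` F. \<kappa> a * (w a \<bullet> w a))"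
    using \<kappa>_nonneg by (intro sum_mono mult_left_mono bessel_inequality[OF I orth])
  also have "\<dots> = (\<Sum>a\<in>z ` F. t a) - real (card (z ` F))"
    by (simp add: w_norm sum_subtractf)
  also have "(\<Sum>a\<in>z ` F. t a) = real (card F)"
    using grp[of "\<lambda>_. 1"] by (simp add: t_def)
  finally have *: "(\<Sum>i\<in>I. laplacian_form F (f i)) \<le> 2 * real (card I) + real (card F) - real (card (z ` F))"
    by simp
  have "card (\<Union>H) = card (z ` F) + card F"
    using disj by (simp add: card_Un_disjoint card_image[OF inj] flip: cover)
  moreover have "(\<Sum>i\<in>I. laplacian_form (H - F) (f i)) \<le> 2 * real (card (H - F))"
    using H by (intro sum_laplacian_form_le_twice_card I orth) (auto simp: simple_graph_def)
  moreover have "real (card (H - F)) = real (card H) - real (card F)"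
    using F by (simp add: card_Diff_subset card_mono of_nat_diff)
  moreover have "laplacian_form H x = laplacian_form F x + laplacian_form (H - F) x" for x
    using F laplacian_form_Un_disjoint[of F "H - F" x] by (simp add: Un_absorb1)
  ultimately show ?thesis using * by (simp add: sum.distrib)
qed

section \<open>Components and edge counts\<close>

lemma reachable_sym: "reachable E u v \<Longrightarrow> reachable E v u"
proof -
  have "sym ({(x, y). {x, y} \<in> E}\<^sup>*)"
    by (intro sym_rtrancl) (auto simp: sym_def insert_commute)
  then show "reachable E u v \<Longrightarrow> reachable E v u" by (auto simp: reachable_def sym_def)
qed

lemma reachable_trans: "reachable E u v \<Longrightarrow> reachable E v w \<Longrightarrow> reachable E u w"
  by (auto simp: reachable_def)

lemma graph_component_eq:
  assumes "C \<in> graph_components V E" "u \<in> C"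
  shows "C = {w \<in> V. reachable E u w}"
  using assms by (auto simp: graph_components_def intro: reachable_sym reachable_trans)

text \<open>A second vertex in the component of \<open>v\<close> is reached by a nonempty path,
  whose first edge contains \<open>v\<close>. Conversely, an edge at \<open>v\<close> puts two
  vertices into the component of \<open>v\<close>.\<close>

lemma Union_nontrivial_components:
  assumes H: "simple_graph V H"
  shows "\<Union>(nontrivial_components V H) = \<Union>H"
proof (intro equalityI subsetI)
  fix v assume "v \<in> \<Union>(nontrivial_components V H)"
  then obtain C where C: "C \<in> graph_components V H" "2 \<le> card C" "v \<in> C"
    by (auto simp: nontrivial_components_def)
  have "\<not> C \<subseteq> {v}"
    using C(2) card_mono[of "{v}" C] by auto
  then obtain w where "w \<in> C" "w \<noteq> v" by blast
  then have "(v, w) \<in> {(x, y). {x, y} \<in> H}\<^sup>*" "v \<noteq> w"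
    using graph_component_eq[OF C(1,3)] by (auto simp: reachable_def)
  then obtain y where "{v, y} \<in> H"
    by (cases rule: converse_rtranclE) auto
  then show "v \<in> \<Union>H" by blast
next
  fix v assume "v \<in> \<Union>H"
  then obtain e where "e \<in> H" "v \<in> e" by blast
  moreover from this have "card e = 2" "e \<subseteq> V" using H by (auto simp: simple_graph_def)
  ultimately obtain w where w: "{v, w} \<in> H" "v \<noteq> w" "{v, w} \<subseteq> V"
    by (auto simp: card_2_iff insert_commute)
  let ?C = "{u \<in> V. reachable H v u}"
  have "{v, w} \<subseteq> ?C" using w by (auto simp: reachable_def)
  moreover have "finite ?C" using H by (simp add: simple_graph_def)
  ultimately have "card {v, w} \<le> card ?C" by (intro card_mono)
  with w have "?C \<in> nontrivial_components V H"
    by (auto simp: nontrivial_components_def graph_components_def)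
  with \<open>{v, w} \<subseteq> ?C\<close> show "v \<in> \<Union>(nontrivial_components V H)" by blast
qed

lemma UN_induced_edges_nontrivial_components:
  assumes H: "simple_graph V H"
  shows "(\<Union>C\<in>nontrivial_components V H. induced_edges H C) = H"
proof (intro equalityI subsetI)
  fix e assume e: "e \<in> H"
  then have "card e = 2" and eV: "e \<subseteq> V" using H by (auto simp: simple_graph_def)
  then obtain u v where uv: "e = {u, v}" by (auto simp: card_2_iff)
  then have "u \<in> \<Union>(nontrivial_components V H)"
    using e unfolding Union_nontrivial_components[OF H] by (intro UnionI[of e]) auto
  then obtain C where C: "C \<in> nontrivial_components V H" "u \<in> C" by blast
  then have "C = {w \<in> V. reachable H u w}"
    by (intro graph_component_eq) (auto simp: nontrivial_components_def)
  moreover have "reachable H u v" using e uv by (auto simp: reachable_def)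
  ultimately have "e \<subseteq> C" using C(2) eV uv by auto
  then show "e \<in> (\<Union>C\<in>nontrivial_components V H. induced_edges H C)"
    using C(1) e by (auto simp: induced_edges_def)
qed (auto simp: induced_edges_def)

lemma disjoint_graph_components:
  assumes "C \<in> graph_components V H" "D \<in> graph_components V H" "C \<noteq> D"
  shows "C \<inter> D = {}"
proof (rule ccontr)
  assume "C \<inter> D \<noteq> {}"
  then obtain u where "u \<in> C" "u \<in> D" by blast
  then have "C = D"
    by (intro trans[OF graph_component_eq[OF assms(1)] graph_component_eq[OF assms(2), symmetric]])
  with assms(3) show False ..
qed

text \<open>Non-trivial components partition both the edges and the non-isolated vertices, so the
  \<open>c\<close>-cyclic equations can be summed. The additive form stays clear of truncated
  subtraction.\<close>

lemma card_edges_c_cyclic_components: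
  assumes H: "simple_graph V H"
    and c: "\<And>C. C \<in> nontrivial_components V H \<Longrightarrow> c_cyclic c C (induced_edges H C)"
  shows "card H + card (nontrivial_components V H)
    = card (\<Union>H) + card (nontrivial_components V H) * c"
proof -
  let ?N = "nontrivial_components V H"
  have fin: "finite V" using H by (simp add: simple_graph_def)
  have N: "C \<subseteq> V" "finite C" if "C \<in> ?N" for C
    using that fin by (auto simp: nontrivial_components_def graph_components_def)
  then have finN: "finite ?N" using fin by (intro finite_subset[of ?N "Pow V"]) auto
  have "finite H" using H fin by (intro finite_subset[of H "Pow V"]) (auto simp: simple_graph_def)
  have disj: "C \<inter> D = {}" if "C \<in> ?N" "D \<in> ?N" "C \<noteq> D" for C D
    using that by (intro disjoint_graph_components) (auto simp: nontrivial_components_def)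
  have "induced_edges H C \<inter> induced_edges H D = {}" if "C \<in> ?N" "D \<in> ?N" "C \<noteq> D" for C D
  proof -
    \<comment> \<open>An empty edge would lie inside every component; edges with an endpoint cannot
      lie in two disjoint ones.\<close>
    have "e \<noteq> {}" if "e \<in> H" for e using that H by (auto simp: simple_graph_def)
    then show ?thesis using disj[OF that] by (auto simp: induced_edges_def)
  qed
  then have "card (\<Union>C\<in>?N. induced_edges H C) = (\<Sum>C\<in>?N. card (induced_edges H C))"
    using finN \<open>finite H\<close> by (intro card_UN_disjoint) (auto simp: induced_edges_def)
  then have "card H + card ?N = (\<Sum>C\<in>?N. card (induced_edges H C) + 1)"
    unfolding sum.distrib by (simp add: UN_induced_edges_nontrivial_components[OF H])
  also have "\<dots> = (\<Sum>C\<in>?N. card C + c)"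
    using c by (intro sum.cong) (auto simp: c_cyclic_def)
  also have "\<dots> = card (\<Union>?N) + card ?N * c"
    using N disj by (subst card_Union_disjoint) (auto simp: pairwise_def disjnt_def sum.distrib)
  finally show ?thesis by (simp add: Union_nontrivial_components[OF H])
qed

section \<open>Combination of the clique and star forest bounds\<close>

theorem theorem2p4:
  fixes E H :: "'v::finite set set" and K :: "'v set"
    and n m \<omega> r c k :: nat and \<gamma>1 \<Delta>1 \<beta>1 :: real
  assumes "connected_graph (UNIV :: 'v set) E"
    and "n = CARD('v)" and "n \<ge> 4"
    and "m = card E"
    and "\<omega> = clique_number (UNIV :: 'v set) E" and "\<omega> \<ge> 2"
    and "clique (UNIV :: 'v set) E K" and "card K = \<omega>"
    and "H = E - induced_edges E K"
    and "r = card (nontrivial_components (UNIV :: 'v set) H)"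
    and "\<forall>C \<in> nontrivial_components (UNIV :: 'v set) H. c_cyclic c C (induced_edges H C)"
    and "\<gamma>1 = (2 * real \<omega> + 3 - sqrt (16 * real \<omega> + 8 * real r * (real c - 1) + 9)) / 2"
    and "\<Delta>1 = min (real \<omega> - 2) \<gamma>1"
    and "\<beta>1 = (3 + sqrt (4 * (real \<omega>)\<^sup>2 - 4 * real \<omega> + 8 * real r * (real c - 1) + 9)) / 2"
    and "1 \<le> real k \<and> real k \<le> \<Delta>1 \<or> \<beta>1 \<le> real k \<and> real k \<le> real n"
  shows "laplacian_sum E k \<le> real m + real k * (real k + 1) / 2"
proof -
  have E: "simple_graph UNIV E" using assms(1) by (simp add: connected_graph_def)
  then have H: "simple_graph UNIV H" by (simp add: assms(9) simple_graph_def)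
  define D where "D = induced_edges E K"
  have D: "D = {e. e \<subseteq> K \<and> card e = 2}"
  proof (intro equalityI subsetI)
    fix e assume "e \<in> {e. e \<subseteq> K \<and> card e = 2}"
    then obtain u v where "e = {u, v}" "u \<noteq> v" "u \<in> K" "v \<in> K" by (auto simp: card_2_iff)
    then show "e \<in> D" using assms(7) by (auto simp: D_def induced_edges_def clique_def)
  qed (use E in \<open>auto simp: D_def induced_edges_def simple_graph_def\<close>)
  have "card D = \<omega> choose 2" by (simp add: D n_subsets assms(8))
  \<comment> \<open>Parity makes the integer division in \<open>choose_two\<close> exact.\<close>
  moreover have "even (\<omega> * (\<omega> - 1))" by (cases \<omega>) auto
  ultimately have "2 * card D = \<omega> * (\<omega> - 1)" by (simp add: choose_two)
  then have "2 * real (card D) = real \<omega> * real (\<omega> - 1)" by (metis of_nat_mult of_nat_numeral)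
  then have card_D: "real (card D) = real \<omega> * (real \<omega> - 1) / 2"
    using assms(6) by (simp add: of_nat_diff)
  have DH: "D \<inter> H = {}" "E = D \<union> H" by (auto simp: D_def assms(9) induced_edges_def)
  then have m: "real m = real (card D) + real (card H)"
    by (simp add: assms(4) card_Un_disjoint)
  \<comment> \<open>In the first range \<open>k\<close> is at most \<open>\<omega> - 2\<close>, and
    the clique fits into the vertex set; the second range bounds \<open>k\<close> by
    \<open>n\<close> directly.\<close>
  have "k \<le> CARD('v)"
  proof -
    have "\<omega> \<le> CARD('v)" using card_mono[of UNIV K] assms(8) by simp
    then show ?thesis using assms(2,13,15) by auto
  qed
  then obtain f :: "'v \<Rightarrow> real^'v" and I
    where orth: "\<And>i j. f i \<bullet> f j = (if i = j then 1 else 0)" and I: "card I = k"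
      and "(\<Sum>i<k. eigenvalue_list (laplacian E) ! i) = (\<Sum>i\<in>I. f i \<bullet> (laplacian E *v f i))"
    by (rule sum_eigenvalue_list[OF transpose_laplacian[of E]]) blast
  then have S: "laplacian_sum E k = (\<Sum>i\<in>I. laplacian_form E (f i))"
    by (simp add: laplacian_sum_def laplacian_form_def)
  have "card H + r = card (\<Union>H) + r * c"
    using card_edges_c_cyclic_components[OF H, of c] assms(10,11) by simp
  then have "real (card H) + real r = real (card (\<Union>H)) + real r * real c"
    by (metis of_nat_add of_nat_mult)
  moreover have "(\<Sum>i\<in>I. laplacian_form H (f i)) \<le> 2 * real k + 2 * real (card H) - real (card (\<Union>H))"
    using sum_laplacian_form_star_bound[OF H finite orth, of I] I by simp
  moreover have "laplacian_sum E k = (\<Sum>i\<in>I. laplacian_form D (f i)) + (\<Sum>i\<in>I. laplacian_form H (f i))"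
    unfolding S by (simp add: DH laplacian_form_Un_disjoint sum.distrib)
  \<comment> \<open>The component count turns \<open>2 * card H - card (\<Union>H)\<close> into
    \<open>card H + r * (c - 1)\<close>. The term \<open>card H\<close> then cancels against its
    share of \<open>m\<close>.\<close>
  ultimately have main: "laplacian_sum E k
      \<le> (\<Sum>i\<in>I. laplacian_form D (f i)) + real (card H) + 2 * real k + real r * (real c - 1)"
    by (simp add: right_diff_distrib)
  \<comment> \<open>Isabelle's square root is odd, hence negative on negative arguments; both bounds on \<open>k\<close> still
    imply the corresponding quadratic inequality.\<close>
  have sq: "x \<le> y\<^sup>2" if "sqrt x \<le> y" for x y :: real
    using that sqrt_ge_absD by (smt (verit) real_sqrt_ge_zero real_sqrt_pow2 power_mono zero_le_power2)
  from assms(15) show ?thesis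
  proof
    assume k: "1 \<le> real k \<and> real k \<le> \<Delta>1"
    then have "sqrt (16 * real \<omega> + 8 * real r * (real c - 1) + 9) \<le> 2 * real \<omega> + 3 - 2 * real k"
      by (simp add: assms(12,13))
    \<comment> \<open>Squared out and divided by 8, this is \<open>k * \<omega> + 2 * k + r * (c -
      1) \<le> \<omega> * (\<omega> - 1) / 2 + k * (k + 1) / 2\<close>, exactly what the eigenvalue
      bound for the clique requires.\<close>
    note sq[OF this]
    moreover have "(\<Sum>i\<in>I. laplacian_form D (f i)) \<le> (\<Sum>i\<in>I. real \<omega>)"
    proof (rule sum_mono)
      show "laplacian_form D (f i) \<le> real \<omega>" for i
        using laplacian_form_complete_le[OF D, of "f i"] by (simp add: assms(8) orth)
    qed
    ultimately show ?thesis
      using main by (simp add: m card_D I power2_eq_square field_simps)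
  next
    assume k: "\<beta>1 \<le> real k \<and> real k \<le> real n"
    then have "sqrt (4 * (real \<omega>)\<^sup>2 - 4 * real \<omega> + 8 * real r * (real c - 1) + 9) \<le> 2 * real k - 3"
      by (simp add: assms(14))
    \<comment> \<open>In the same way this is \<open>\<omega> * (\<omega> - 1) / 2 + 2 * k + r * (c
      - 1) \<le> k * (k + 1) / 2\<close>, which matches the trace bound for the clique.\<close>
    note sq[OF this]
    moreover have "(\<Sum>i\<in>I. laplacian_form D (f i)) \<le> 2 * real (card D)"
      using E by (intro sum_laplacian_form_le_twice_card orth) (auto simp: simple_graph_def DH)
    ultimately show ?thesis
      using main by (simp add: m card_D power2_eq_square field_simps)
  qed
qed

end
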